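(* Let $\rho>0$, $\alpha\in(0,1)$ and $T>0$. Let $u:[0,T]\to\mathbb{R}^m$, $A\in\mathbb{R}^{n\times n}$ and $B\in\mathbb{R}^{n\times m}$, with the property that $\det[(s+\rho)^{\alpha}I-A]\neq 0$ for $s\geq\|A\|^{1/\alpha}$. Let $y_0\in\mathbb{R}^n$. Then the solution $y:[0,T]\to\mathbb{R}^n$ of the linear tempered fractional system $$ {}^T D_0^{\alpha,\rho}y(t)=Ay(t)+Bu(t),\quad t\in[0,T],\qquad y(0)=y_0, $$ is given by $$ y(t)=e^{-\rho t}E_\alpha(At^\alpha)y_0+\int_0^t e^{-\rho(t-\tau)}(t-\tau)^{\alpha-1}E_{\alpha,\alpha}\big(A(t-\tau)^\alpha\big)Bu(\tau)\,d\tau. $$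
   Context: For $\alpha\in(0,1)$ and $\rho>0$, the Caputo tempered fractional derivative of a function $v$ (a $C^1$ function; applied componentwise to vector-valued functions) is $$ {}^T D_0^{\alpha,\rho}v(t)=\frac{1}{\Gamma(1-\alpha)}\int_0^t e^{-\rho(t-s)}(t-s)^{-\alpha}\big(\rho v(s)+v'(s)\big)\,ds, $$ where $\Gamma$ is the Euler gamma function. The Mittag-Leffler functions of a square matrix $M$ are $E_\alpha(M)=\sum_{l=0}^{\infty}\frac{M^l}{\Gamma(\alpha l+1)}$ and $E_{\alpha,\alpha'}(M)=\sum_{l=0}^{\infty}\frac{M^l}{\Gamma(\alpha l+\alpha')}$, for $\alpha,\alpha'>0$. $\|\cdot\|$ is a matrix norm and $I$ is the identity matrix. *)

theory Defs
  imports "HOL-Analysis.Analysis"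
begin

definition C1_on_Icc :: "(real \<Rightarrow> 'a::real_normed_vector) \<Rightarrow> real \<Rightarrow> bool" where
  (* Unlike C1_differentiable_on, the derivatives at the endpoints are one-sided. *)
  "C1_on_Icc v T \<longleftrightarrow>
     (\<exists>v'. (\<forall>t\<in>{0..T}. (v has_vector_derivative v' t) (at t within {0..T})) \<and>
           continuous_on {0..T} v')"

definition caputo_tempered ::
  "real \<Rightarrow> real \<Rightarrow> (real \<Rightarrow> 'a::euclidean_space) \<Rightarrow> real \<Rightarrow> 'a" where
  (* For s < t this is the ordinary derivative v' s (one-sided at 0); taking it within {0..t}
     makes the value depend only on v restricted to {0..t}. *)
  "caputo_tempered \<alpha> \<rho> v t =
     (1 / Gamma (1 - \<alpha>)) *\<^sub>R
     integral {0..t} (\<lambda>s. (exp (- \<rho> * (t - s)) * (t - s) powr (- \<alpha>)) *\<^sub>R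
                          (\<rho> *\<^sub>R v s + vector_derivative v (at s within {0..t})))"

primrec matrix_pow :: "real^'n^'n \<Rightarrow> nat \<Rightarrow> real^'n^'n" where
  (* The operations * and ^ on real^'n^'n are componentwise, hence a separate power for **. *)
  "matrix_pow M 0 = mat 1"
| "matrix_pow M (Suc k) = M ** matrix_pow M k"

definition mittag_leffler :: "real \<Rightarrow> real^'n^'n \<Rightarrow> real^'n^'n" where
  "mittag_leffler \<alpha> M = (\<Sum>l. (1 / Gamma (\<alpha> * real l + 1)) *\<^sub>R matrix_pow M l)"

definition mittag_leffler2 :: "real \<Rightarrow> real \<Rightarrow> real^'n^'n \<Rightarrow> real^'n^'n" where
  "mittag_leffler2 \<alpha> \<beta> M = (\<Sum>l. (1 / Gamma (\<alpha> * real l + \<beta>)) *\<^sub>R matrix_pow M l)"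

definition matrix_norm :: "(real^'n^'n \<Rightarrow> real) \<Rightarrow> bool" where
  "matrix_norm N \<longleftrightarrow>
     (\<forall>M. 0 \<le> N M) \<and> (\<forall>M. N M = 0 \<longleftrightarrow> M = 0) \<and>
     (\<forall>c M. N (c *\<^sub>R M) = \<bar>c\<bar> * N M) \<and>
     (\<forall>M M'. N (M + M') \<le> N M + N M') \<and>
     (\<forall>M M'. N (M ** M') \<le> N M * N M')"

definition tempered_solution ::
  "real \<Rightarrow> real \<Rightarrow> real \<Rightarrow> real^'n^'n \<Rightarrow> real^'m^'n \<Rightarrow> (real \<Rightarrow> real^'m) \<Rightarrow> real^'n \<Rightarrow>
   (real \<Rightarrow> real^'n) \<Rightarrow> bool" where
  "tempered_solution \<alpha> \<rho> T A B u y0 y \<longleftrightarrow>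
     C1_on_Icc y T \<and>
     (\<forall>t\<in>{0..T}. caputo_tempered \<alpha> \<rho> y t = A *v y t + B *v u t) \<and>
     y 0 = y0"

end

theory Submission
  imports Defs "HOL-Real_Asymp.Real_Asymp"
begin

text \<open>
  Multiplication by \<open>exp (\<rho> t)\<close> removes the tempering: with \<open>z(t) = exp (\<rho> t) y(t)\<close> one has
  \<open>z'(s) = exp (\<rho> s) (\<rho> y(s) + y'(s))\<close>, so the system becomes the Caputo system
  \<open>J^(1-\<alpha>) z' = A z + g\<close> with \<open>g(t) = exp (\<rho> t) B u(t)\<close>. Here \<open>J^c\<close> is the Riemann--Liouville
  integral of order \<open>c\<close>, that is, convolution with \<open>k_c(r) = r^(c-1) / \<Gamma>(c)\<close> on \<open>r > 0\<close>.

  The Beta integral gives \<open>k_a * k_b = k_(a+b)\<close> (\<open>rl_kernel_convolution\<close>), and Fubini turns this into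
  the semigroup law \<open>J^a J^b = J^(a+b)\<close> (\<open>rl_integral_semigroup\<close>). The Mittag-Leffler kernel
  \<open>r^(\<alpha>-1) E_(\<alpha>,\<alpha>)(A r^\<alpha>)\<close> is the Neumann series \<open>\<Sum>l. A^l k_(\<alpha>l+\<alpha>)(r)\<close>. Applying its \<open>l\<close>-th term to
  \<open>g = J^(1-\<alpha>) z' - A z\<close> and using \<open>z = k_1 z(0) + J^1 z'\<close> gives
  \<open>A^l J^(\<alpha>l+\<alpha>) g = A^l J^(\<alpha>l) z - A^(l+1) J^(\<alpha>(l+1)) z - A^l k_(\<alpha>l+1) z(0)\<close>,
  with \<open>J^0 z = z\<close>. The sum over \<open>l\<close> telescopes to \<open>z(t) - E_\<alpha>(A t^\<alpha>) z(0)\<close>, which is the claim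
  multiplied by \<open>exp (\<rho> t)\<close>. The interchange of sum and integral (in
  \<open>variation_of_constants_riemann_liouville\<close>) and the
  vanishing of the remainder \<open>A^l J^(\<alpha>l) z\<close> rest on the absolute convergence of the
  scalar Mittag-Leffler series (\<open>summable_mittag_leffler\<close>), for which log-convexity of \<open>\<Gamma>\<close> supplies the
  ratio test.
\<close>

section \<open>Riemann--Liouville integrals of causal functions\<close>

text \<open>
  Cutting the kernel off at \<open>0\<close> makes the integrals over \<open>[0,t]\<close>, \<open>[s,t]\<close> and so on into
  convolutions over the whole line, so that Fubini and translation apply without
  changes of the domain of integration.
\<close>

definition rl_kernel :: "real \<Rightarrow> real \<Rightarrow> real" where
  "rl_kernel c r = (if r > 0 then r powr (c - 1) / Gamma c else 0)"

definition rl_integral :: "real \<Rightarrow> (real \<Rightarrow> 'a::euclidean_space) \<Rightarrow> real \<Rightarrow> 'a" where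
  "rl_integral c f t = (\<integral>s. rl_kernel c (t - s) *\<^sub>R f s \<partial>lborel)"

text \<open>
  The value at \<open>0\<close> is required to vanish as well, so that the bound by \<open>M\<close> times the Heaviside
  function holds pointwise and not only almost everywhere. Bounding \<open>f\<close> only below \<open>t\<close> matters because
  \<open>rl_integral 1 f\<close> may grow without bound.
\<close>

definition causal_bounded :: "real \<Rightarrow> real \<Rightarrow> (real \<Rightarrow> 'a::euclidean_space) \<Rightarrow> bool" where
  "causal_bounded M t f \<longleftrightarrow>
     0 \<le> M \<and> f \<in> borel_measurable borel \<and> (\<forall>s\<le>0. f s = 0) \<and> (\<forall>s<t. norm (f s) \<le> M)"

lemma rl_kernel_nonneg: "0 < c \<Longrightarrow> 0 \<le> rl_kernel c r"
  by (simp add: rl_kernel_def less_imp_le)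

lemma measurable_rl_kernel [measurable]: "rl_kernel c \<in> borel_measurable borel"
  unfolding rl_kernel_def by measurable

lemma rl_kernel_mono: "1 \<le> c \<Longrightarrow> r \<le> s \<Longrightarrow> rl_kernel c r \<le> rl_kernel c s"
  by (auto simp: rl_kernel_def divide_right_mono powr_mono2 less_imp_le)

text \<open>
  The substitution \<open>\<tau> = s + (t - s) \<sigma>\<close> reduces the convolution to Euler's Beta integral.
\<close>

lemma rl_kernel_convolution:
  assumes "0 < a" "0 < b"
  shows "has_bochner_integral lborel (\<lambda>\<tau>. rl_kernel a (t - \<tau>) * rl_kernel b (\<tau> - s))
           (rl_kernel (a + b) (t - s))"
proof (cases "s < t")
  case False
  then have "(\<lambda>\<tau>. rl_kernel a (t - \<tau>) * rl_kernel b (\<tau> - s)) = (\<lambda>\<tau>. 0)"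
    by (auto simp: rl_kernel_def fun_eq_iff)
  moreover have "rl_kernel (a + b) (t - s) = 0"
    using False by (simp add: rl_kernel_def)
  ultimately show ?thesis by (simp add: has_bochner_integral_zero)
next
  case True
  define x where "x = t - s"
  have x: "x > 0" using True by (simp add: x_def)
  define C where "C = x powr (a + b - 2) / (Gamma a * Gamma b)"
  have "has_bochner_integral lborel
          (\<lambda>\<sigma>. indicator {0..1} \<sigma> *\<^sub>R (\<sigma> powr (b - 1) * (1 - \<sigma>) powr (a - 1))) (Beta b a)"
    using integrable_Beta[OF assms(2,1)] has_integral_Beta_real[OF assms(2,1)]
      set_borel_integral_eq_integral[OF integrable_Beta[OF assms(2,1)]]
    by (auto simp: has_bochner_integral_iff set_integrable_def set_lebesgue_integral_def
        dest: integral_unique)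
  then have "has_bochner_integral lborel
          (\<lambda>\<sigma>. C * (indicator {0..1} \<sigma> *\<^sub>R (\<sigma> powr (b - 1) * (1 - \<sigma>) powr (a - 1)))) (C * Beta b a)"
    by (intro has_bochner_integral_mult_right)
  also have "(\<lambda>\<sigma>. C * (indicator {0..1} \<sigma> *\<^sub>R (\<sigma> powr (b - 1) * (1 - \<sigma>) powr (a - 1)))) =
      (\<lambda>\<sigma>. rl_kernel a (t - (s + x * \<sigma>)) * rl_kernel b ((s + x * \<sigma>) - s))"
  proof
    fix \<sigma> :: real
    have e: "t - (s + x * \<sigma>) = x * (1 - \<sigma>)" "(s + x * \<sigma>) - s = x * \<sigma>"
      by (simp_all add: x_def algebra_simps)
    have p: "x powr (a + b - 2) = x powr (a - 1) * x powr (b - 1)"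
      by (simp add: powr_add[symmetric])
    show "C * (indicator {0..1} \<sigma> *\<^sub>R (\<sigma> powr (b - 1) * (1 - \<sigma>) powr (a - 1))) =
        rl_kernel a (t - (s + x * \<sigma>)) * rl_kernel b ((s + x * \<sigma>) - s)"
      unfolding e using x
      by (auto simp: rl_kernel_def C_def p powr_mult zero_less_mult_iff indicator_def)
  qed
  also have "C * Beta b a = rl_kernel (a + b) (t - s) /\<^sub>R \<bar>x\<bar>"
  proof -
    have "x powr (a + b - 1) = x powr (a + b - 2) * x"
      using x by (simp add: powr_diff power2_eq_square)
    moreover have "Gamma a > 0" "Gamma b > 0" "Gamma (a + b) > 0"
      using assms by auto
    ultimately show ?thesis
      using x by (simp add: C_def rl_kernel_def Beta_def x_def[symmetric] add.commute[of b a] field_simps)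
  qed
  finally show ?thesis
    using lborel_has_bochner_integral_real_affine_iff[of x
        "\<lambda>\<tau>. rl_kernel a (t - \<tau>) * rl_kernel b (\<tau> - s)" _ s] x by simp
qed

lemma rl_kernel_one: "rl_kernel 1 r = indicator {0<..} r"
  by (auto simp: rl_kernel_def)

lemma causal_bounded_mono: "causal_bounded M t f \<Longrightarrow> s \<le> t \<Longrightarrow> causal_bounded M s f"
  by (auto simp: causal_bounded_def)

text \<open>
  On \<open>s > 0\<close> a causal function is dominated by \<open>M\<close> times the Heaviside function
  \<open>rl_kernel 1\<close>, whose integral of order \<open>c\<close> is \<open>rl_kernel (c + 1)\<close>.
\<close>

lemma rl_integral_bound:
  fixes f :: "real \<Rightarrow> 'a::euclidean_space"
  assumes f: "causal_bounded M t f" and c: "0 < c"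
  shows "integrable lborel (\<lambda>s. rl_kernel c (t - s) *\<^sub>R f s)"
    and "(\<integral>s. norm (rl_kernel c (t - s) *\<^sub>R f s) \<partial>lborel) \<le> M * rl_kernel (c + 1) t"
    and "norm (rl_integral c f t) \<le> M * rl_kernel (c + 1) t"
proof -
  have [measurable]: "f \<in> borel_measurable borel" using f by (simp add: causal_bounded_def)
  have dom: "has_bochner_integral lborel (\<lambda>s. M * (rl_kernel c (t - s) * rl_kernel 1 (s - 0)))
      (M * rl_kernel (c + 1) (t - 0))"
    using c by (intro has_bochner_integral_mult_right rl_kernel_convolution) auto
  have le: "norm (rl_kernel c (t - s) *\<^sub>R f s) \<le> M * (rl_kernel c (t - s) * rl_kernel 1 (s - 0))" for s
  proof (cases "0 < s \<and> s < t")
    case True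
    then have "rl_kernel c (t - s) * norm (f s) \<le> rl_kernel c (t - s) * M"
      using f c by (intro mult_left_mono rl_kernel_nonneg) (auto simp: causal_bounded_def)
    with True show ?thesis
      using rl_kernel_nonneg[OF c, of "t - s"] by (simp add: rl_kernel_one mult.commute)
  next
    case False
    then show ?thesis
      using f by (auto simp: rl_kernel_def causal_bounded_def)
  qed
  show int: "integrable lborel (\<lambda>s. rl_kernel c (t - s) *\<^sub>R f s)"
    by (rule Bochner_Integration.integrable_bound[OF integrable.intros[OF dom]])
      (auto intro!: AE_I2 order_trans[OF le] simp del: norm_scaleR)
  show *: "(\<integral>s. norm (rl_kernel c (t - s) *\<^sub>R f s) \<partial>lborel) \<le> M * rl_kernel (c + 1) t"
    using integral_mono[OF integrable_norm[OF int] integrable.intros[OF dom] le]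
    unfolding has_bochner_integral_integral_eq[OF dom] by simp
  show "norm (rl_integral c f t) \<le> M * rl_kernel (c + 1) t"
    unfolding rl_integral_def by (rule order_trans[OF integral_norm_bound *])
qed

lemma measurable_rl_integral [measurable]:
  fixes f :: "real \<Rightarrow> 'a::euclidean_space"
  assumes [measurable]: "f \<in> borel_measurable borel"
  shows "rl_integral c f \<in> borel_measurable borel"
proof -
  have "(\<lambda>t. \<integral>s. rl_kernel c (t - s) *\<^sub>R f s \<partial>lborel) \<in> borel_measurable lborel"
    by measurable
  then show ?thesis by (simp add: rl_integral_def[abs_def])
qed

lemma causal_bounded_rl_integral:
  fixes f :: "real \<Rightarrow> 'a::euclidean_space"
  assumes f: "causal_bounded M t f" and c: "0 < c"
  shows "causal_bounded (M * rl_kernel (c + 1) t) t (rl_integral c f)"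
proof -
  have M: "0 \<le> M" "f \<in> borel_measurable borel" using f by (auto simp: causal_bounded_def)
  have zero: "rl_integral c f s = 0" if "s \<le> 0" for s
  proof -
    have "(\<lambda>r. rl_kernel c (s - r) *\<^sub>R f r) = (\<lambda>r. 0)"
      using that f by (auto simp: causal_bounded_def rl_kernel_def fun_eq_iff)
    then show ?thesis by (simp add: rl_integral_def)
  qed
  have "norm (rl_integral c f s) \<le> M * rl_kernel (c + 1) t" if "s < t" for s
  proof -
    have "norm (rl_integral c f s) \<le> M * rl_kernel (c + 1) s"
      using causal_bounded_mono[OF f, of s] that c by (intro rl_integral_bound) auto
    also have "\<dots> \<le> M * rl_kernel (c + 1) t"
      using M c that by (intro mult_left_mono rl_kernel_mono) auto
    finally show ?thesis .
  qed
  then show ?thesis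
    using M c zero by (auto simp: causal_bounded_def intro!: mult_nonneg_nonneg rl_kernel_nonneg)
qed

text \<open>
  Fubini for \<open>rl_kernel a (t - \<tau>) * rl_kernel b (\<tau> - s) * f s\<close>: integrating over \<open>\<tau>\<close> first leaves
  the kernel of order \<open>a + b\<close>. Since the kernels are nonnegative, the same computation with \<open>norm (f s)\<close>
  yields the integrability on the product.
\<close>

lemma rl_integral_semigroup:
  fixes f :: "real \<Rightarrow> 'a::euclidean_space"
  assumes f: "causal_bounded M t f" and ab: "0 < a" "0 < b"
  shows "rl_integral a (rl_integral b f) t = rl_integral (a + b) f t"
proof -
  define F where "F s \<tau> = (rl_kernel a (t - \<tau>) * rl_kernel b (\<tau> - s)) *\<^sub>R f s" for s \<tau>
  have [measurable]: "f \<in> borel_measurable borel" using f by (simp add: causal_bounded_def)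
  have inner: "has_bochner_integral lborel (F s) (rl_kernel (a + b) (t - s) *\<^sub>R f s)" for s
    unfolding F_def[abs_def]
    by (rule has_bochner_integral_scaleR_left[OF rl_kernel_convolution[OF ab]])
  have nrm: "norm (F s \<tau>) = (rl_kernel a (t - \<tau>) * rl_kernel b (\<tau> - s)) * norm (f s)" for s \<tau>
    using ab by (simp add: F_def rl_kernel_nonneg)
  have inner_norm: "(\<integral>\<tau>. norm (F s \<tau>) \<partial>lborel) = norm (rl_kernel (a + b) (t - s) *\<^sub>R f s)" for s
    unfolding nrm
    using has_bochner_integral_integral_eq[OF rl_kernel_convolution[OF ab, of t s]] ab
    by (simp add: rl_kernel_nonneg)
  have int: "integrable (lborel \<Otimes>\<^sub>M lborel) (case_prod F)"
  proof (rule lborel_pair.Fubini_integrable)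
    show "case_prod F \<in> borel_measurable (lborel \<Otimes>\<^sub>M lborel)"
      unfolding F_def by measurable
    show "integrable lborel (\<lambda>s. \<integral>\<tau>. norm (case_prod F (s, \<tau>)) \<partial>lborel)"
      using rl_integral_bound(1)[OF f, of "a + b"] ab by (simp add: inner_norm del: norm_scaleR)
    show "AE s in lborel. integrable lborel (\<lambda>\<tau>. case_prod F (s, \<tau>))"
      using inner by (auto simp: has_bochner_integral_iff)
  qed
  have "rl_integral a (rl_integral b f) t = (\<integral>\<tau>. (\<integral>s. F s \<tau> \<partial>lborel) \<partial>lborel)"
    by (simp add: rl_integral_def F_def flip: scaleR_scaleR)
  also have "\<dots> = (\<integral>s. (\<integral>\<tau>. F s \<tau> \<partial>lborel) \<partial>lborel)"
    by (rule lborel_pair.Fubini_integral[OF int])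
  also have "\<dots> = rl_integral (a + b) f t"
    using inner by (simp add: has_bochner_integral_iff rl_integral_def)
  finally show ?thesis .
qed

section \<open>Convergence of Mittag-Leffler series\<close>

text \<open>
  Since \<open>x + 1\<close> is the convex combination \<open>(1 - \<alpha>) (x + \<alpha> + 1) + \<alpha> (x + \<alpha>)\<close>, log-convexity
  compares \<open>\<Gamma>(x + 1) = x \<Gamma>(x)\<close> with \<open>\<Gamma>(x + \<alpha> + 1) = (x + \<alpha>) \<Gamma>(x + \<alpha>)\<close>.
  As a bound for \<open>\<Gamma>(x) / \<Gamma>(x + \<alpha>)\<close> this tends to \<open>0\<close> as \<open>x\<close> grows.
\<close>

lemma Gamma_shift_bound:
  fixes x \<alpha> :: real
  assumes "0 < x" "0 < \<alpha>" "\<alpha> < 1"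
  shows "x * Gamma x \<le> (x + \<alpha>) powr (1 - \<alpha>) * Gamma (x + \<alpha>)"
proof -
  have "(ln \<circ> Gamma) ((1 - \<alpha>) *\<^sub>R (x + \<alpha> + 1) + \<alpha> *\<^sub>R (x + \<alpha>)) \<le>
      (1 - \<alpha>) * (ln \<circ> Gamma) (x + \<alpha> + 1) + \<alpha> * (ln \<circ> Gamma) (x + \<alpha>)"
    using assms by (intro convex_onD[OF log_convex_Gamma_real, of \<alpha>]) auto
  also have "(1 - \<alpha>) *\<^sub>R (x + \<alpha> + 1) + \<alpha> *\<^sub>R (x + \<alpha>) = x + 1"
    by (simp add: algebra_simps)
  finally have *: "ln (Gamma (x + 1)) \<le> (1 - \<alpha>) * ln (Gamma (x + \<alpha> + 1)) + \<alpha> * ln (Gamma (x + \<alpha>))"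
    by simp
  have G: "Gamma (x + 1) = x * Gamma x" "Gamma (x + \<alpha> + 1) = (x + \<alpha>) * Gamma (x + \<alpha>)"
    using assms by (auto intro!: Gamma_plus1 simp: nonpos_Ints_def)
  have pos: "Gamma x > 0" "Gamma (x + \<alpha>) > 0" using assms by auto
  have "ln (x * Gamma x) \<le> ln ((x + \<alpha>) powr (1 - \<alpha>) * Gamma (x + \<alpha>))"
    using * assms pos unfolding G
    by (simp add: ln_mult ln_powr less_imp_neq[THEN not_sym] add_pos_pos distrib_left left_diff_distrib)
  then show ?thesis
    using assms pos by (subst (asm) ln_le_cancel_iff) auto
qed

lemma summable_mittag_leffler:
  fixes x \<alpha> \<beta> :: real
  assumes "0 < \<alpha>" "\<alpha> < 1" "0 < \<beta>" "0 \<le> x"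
  shows "summable (\<lambda>l. x ^ l / Gamma (\<alpha> * real l + \<beta>))"
proof -
  define q where "q l = (\<alpha> * real l + \<beta> + \<alpha>) powr (1 - \<alpha>) / (\<alpha> * real l + \<beta>)" for l
  have "q \<longlonglongrightarrow> 0"
    unfolding q_def using assms by real_asymp
  then have "(\<lambda>l. x * q l) \<longlonglongrightarrow> x * 0" by (intro tendsto_intros)
  then have "eventually (\<lambda>l. x * q l < 1/2) sequentially"
    by (intro order_tendstoD) auto
  then obtain L where L: "\<And>l. l \<ge> L \<Longrightarrow> x * q l < 1/2"
    by (auto simp: eventually_sequentially)
  show ?thesis
  proof (rule summable_ratio_test[of "1/2" L])
    fix l assume "L \<le> l"
    define y where "y = \<alpha> * real l + \<beta>"
    have y: "y > 0" using assms by (auto simp: y_def intro: add_nonneg_pos)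
    then have G: "Gamma y > 0" "Gamma (y + \<alpha>) > 0" using assms by auto
    have "1 / Gamma (y + \<alpha>) \<le> q l / Gamma y"
      using Gamma_shift_bound[OF y assms(1,2)] y G
      unfolding q_def y_def[symmetric] by (simp add: field_simps)
    then have "x ^ Suc l * (1 / Gamma (y + \<alpha>)) \<le> x ^ Suc l * (q l / Gamma y)"
      using assms by (intro mult_left_mono) auto
    also have "\<dots> = (x * q l) * (x ^ l / Gamma y)" by simp
    also have "\<dots> \<le> (1/2) * (x ^ l / Gamma y)"
      using L[OF \<open>L \<le> l\<close>] assms G by (intro mult_right_mono) auto
    finally show "norm (x ^ Suc l / Gamma (\<alpha> * real (Suc l) + \<beta>)) \<le>
        1/2 * norm (x ^ l / Gamma (\<alpha> * real l + \<beta>))"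
      using assms G by (simp add: y_def algebra_simps)
  qed simp
qed

lemma summable_rl_kernel:
  fixes C \<alpha> \<beta> t :: real
  assumes "0 < \<alpha>" "\<alpha> < 1" "0 < \<beta>" "0 \<le> C"
  shows "summable (\<lambda>l. C ^ l * rl_kernel (\<alpha> * real l + \<beta>) t)"
proof (cases "0 < t")
  case True
  have "C ^ l * rl_kernel (\<alpha> * real l + \<beta>) t =
      t powr (\<beta> - 1) * ((C * t powr \<alpha>) ^ l / Gamma (\<alpha> * real l + \<beta>))" for l
    using True
    by (simp add: rl_kernel_def power_mult_distrib powr_power add_diff_eq[symmetric] powr_add mult.commute)
  then show ?thesis
    using summable_mult[OF summable_mittag_leffler[OF assms(1-3), of "C * t powr \<alpha>"]] assms
    by simp
qed (simp add: rl_kernel_def)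

lemma bounded_bilinear_matrix_vector:
  "bounded_bilinear ((*v) :: real^'m^'n \<Rightarrow> real^'m \<Rightarrow> real^'n)"
  unfolding bilinear_conv_bounded_bilinear[symmetric] bilinear_def
  by (intro conjI allI linearI)
    (simp_all only: matrix_vector_mult_add_rdistrib matrix_vector_right_distrib
      matrix_vector_mult_scaleR scaleR_matrix_vector_assoc)

text \<open>
  Left multiplication by \<open>A\<close> is a bounded operator on matrices, so its operator norm serves as \<open>C\<close>.
  The Euclidean norm of the identity is not \<open>1\<close>, hence the factor \<open>D\<close>.
\<close>

lemma matrix_pow_norm_bound:
  fixes A :: "real^'n^'n"
  obtains C D where "0 \<le> C" "0 \<le> D" "\<And>l. norm (matrix_pow A l) \<le> D * C ^ l"
proof -
  have "linear (\<lambda>M::real^'n^'n. A ** M)"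
    by (intro linearI)
      (auto simp: matrix_add_ldistrib matrix_matrix_mult_def vec_eq_iff sum_distrib_left
        distrib_left sum.distrib mult_ac)
  then have bl: "bounded_linear (\<lambda>M::real^'n^'n. A ** M)" by (simp add: linear_conv_bounded_linear)
  define C where "C = onorm (\<lambda>M::real^'n^'n. A ** M)"
  have C: "0 \<le> C" unfolding C_def by (rule onorm_pos_le[OF bl])
  have "norm (matrix_pow A l) \<le> norm (mat 1 :: real^'n^'n) * C ^ l" for l
  proof (induction l)
    case (Suc l)
    have "norm (matrix_pow A (Suc l)) \<le> C * norm (matrix_pow A l)"
      using onorm[OF bl, of "matrix_pow A l"] by (simp add: C_def)
    also have "\<dots> \<le> C * (norm (mat 1 :: real^'n^'n) * C ^ l)"
      using Suc C by (intro mult_left_mono)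
    finally show ?case by (simp add: mult_ac)
  qed simp
  then show thesis using C by (intro that[of C "norm (mat 1 :: real^'n^'n)"]) auto
qed

lemma matrix_pow_vector_bound:
  fixes A :: "real^'n^'n"
  obtains C D where "0 \<le> C" "0 \<le> D" "\<And>l x. norm (matrix_pow A l *v x) \<le> D * C ^ l * norm x"
proof -
  obtain C D where CD: "0 \<le> C" "0 \<le> D" "\<And>l. norm (matrix_pow A l) \<le> D * C ^ l"
    using matrix_pow_norm_bound by blast
  obtain K where K: "0 < K" "\<And>(M::real^'n^'n) x. norm (M *v x) \<le> norm M * norm x * K"
    using bounded_bilinear.pos_bounded[OF bounded_bilinear_matrix_vector[where 'm='n and 'n='n]] by blast
  have "norm (matrix_pow A l *v x) \<le> (K * D) * C ^ l * norm x" for l x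
  proof -
    have "norm (matrix_pow A l *v x) \<le> norm (matrix_pow A l) * norm x * K" by (rule K)
    also have "\<dots> \<le> (D * C ^ l) * norm x * K"
      using CD K by (intro mult_right_mono) auto
    finally show ?thesis by (simp add: mult_ac)
  qed
  then show thesis using CD K by (intro that[of C "K * D"]) auto
qed

lemma matrix_pow_scaleR: "matrix_pow (c *\<^sub>R A) l = c ^ l *\<^sub>R matrix_pow A l"
  by (induction l) (auto simp: matrix_matrix_mult_def vec_eq_iff sum_distrib_left mult_ac)

lemma matrix_pow_Suc_right: "matrix_pow A l *v (A *v x) = matrix_pow A (Suc l) *v x"
  by (induction l) (simp_all add: matrix_vector_mul_assoc[symmetric])

text \<open>
  The link between matrix Mittag-Leffler functions and fractional integration: the \<open>l\<close>-th term,
  applied to \<open>x\<close>, is \<open>A^l x\<close> weighted by a Riemann--Liouville kernel.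
\<close>

lemma mittag_leffler2_eq_rl_kernel_series:
  fixes A :: "real^'n^'n"
  assumes "0 < \<alpha>" "\<alpha> < 1" "0 < \<beta>" "0 < r"
  shows "r powr (\<beta> - 1) *\<^sub>R (mittag_leffler2 \<alpha> \<beta> ((r powr \<alpha>) *\<^sub>R A) *v x) =
    (\<Sum>l. rl_kernel (\<alpha> * real l + \<beta>) r *\<^sub>R (matrix_pow A l *v x))"
proof -
  let ?f = "\<lambda>l. (1 / Gamma (\<alpha> * real l + \<beta>)) *\<^sub>R matrix_pow ((r powr \<alpha>) *\<^sub>R A) l"
  obtain C D where CD: "0 \<le> C" "0 \<le> D" "\<And>l. norm (matrix_pow ((r powr \<alpha>) *\<^sub>R A) l) \<le> D * C ^ l"
    using matrix_pow_norm_bound by blast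
  have "summable ?f"
  proof (rule summable_comparison_test[OF _ summable_mult])
    show "summable (\<lambda>l. C ^ l / Gamma (\<alpha> * real l + \<beta>))"
      using assms CD by (intro summable_mittag_leffler)
    show "\<exists>N. \<forall>l\<ge>N. norm (?f l) \<le> D * (C ^ l / Gamma (\<alpha> * real l + \<beta>))"
    proof (intro exI[of _ 0] allI impI)
      fix l :: nat
      have "Gamma (\<alpha> * real l + \<beta>) > 0"
        using assms by (auto intro!: Gamma_real_pos add_nonneg_pos)
      then show "norm (?f l) \<le> D * (C ^ l / Gamma (\<alpha> * real l + \<beta>))"
        using CD(3)[of l] by (simp add: divide_right_mono)
    qed
  qed
  moreover have "bounded_linear (\<lambda>M::real^'n^'n. r powr (\<beta> - 1) *\<^sub>R (M *v x))"
    by (intro bounded_linear_const_scaleR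
        bounded_bilinear.bounded_linear_left[OF bounded_bilinear_matrix_vector])
  ultimately have "r powr (\<beta> - 1) *\<^sub>R ((\<Sum>l. ?f l) *v x) = (\<Sum>l. r powr (\<beta> - 1) *\<^sub>R (?f l *v x))"
    by (intro bounded_linear.suminf) auto
  also have "\<dots> = (\<Sum>l. rl_kernel (\<alpha> * real l + \<beta>) r *\<^sub>R (matrix_pow A l *v x))"
  proof (rule suminf_cong)
    fix l
    have "r powr (\<alpha> * real l + \<beta> - 1) = r powr (\<beta> - 1) * (r powr \<alpha>) ^ l"
      using assms by (simp add: powr_power add_diff_eq[symmetric] powr_add mult.commute)
    then show "r powr (\<beta> - 1) *\<^sub>R (?f l *v x) =
        rl_kernel (\<alpha> * real l + \<beta>) r *\<^sub>R (matrix_pow A l *v x)"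
      using assms by (simp add: rl_kernel_def matrix_pow_scaleR scaleR_matrix_vector_assoc[symmetric])
  qed
  finally show ?thesis by (simp add: mittag_leffler2_def)
qed

section \<open>The variation of constants formula for the untempered system\<close>

lemma causal_bounded_bounded_linear:
  fixes f :: "real \<Rightarrow> 'a::euclidean_space" and L :: "'a \<Rightarrow> 'b::euclidean_space"
  assumes "causal_bounded M t f" "bounded_linear L" "\<And>x. norm (L x) \<le> C * norm x" "0 \<le> C"
  shows "causal_bounded (C * M) t (\<lambda>s. L (f s))"
proof -
  interpret bounded_linear L by fact
  have "norm (L (f s)) \<le> C * M" if "s < t" for s
    using assms that by (intro order_trans[OF assms(3)] mult_left_mono) (auto simp: causal_bounded_def)
  moreover have "L \<in> borel_measurable borel"
    by (intro borel_measurable_continuous_onI continuous_on) auto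
  ultimately show ?thesis
    using assms by (auto simp: causal_bounded_def zero)
qed

lemma causal_bounded_add:
  "causal_bounded M t f \<Longrightarrow> causal_bounded M' t g \<Longrightarrow> causal_bounded (M + M') t (\<lambda>s. f s + g s)"
  by (auto simp: causal_bounded_def intro: norm_triangle_mono)

lemma causal_bounded_diff:
  "causal_bounded M t f \<Longrightarrow> causal_bounded M' t g \<Longrightarrow> causal_bounded (M + M') t (\<lambda>s. f s - g s)"
  by (auto simp: causal_bounded_def intro: order_trans[OF norm_triangle_ineq4 add_mono])

lemma causal_bounded_heaviside: "causal_bounded (norm x) t (\<lambda>s. rl_kernel 1 s *\<^sub>R x)"
  by (auto simp: causal_bounded_def rl_kernel_one indicator_def)

lemma rl_integral_heaviside:
  assumes "0 < c"
  shows "rl_integral c (\<lambda>s. rl_kernel 1 s *\<^sub>R x) t = rl_kernel (c + 1) t *\<^sub>R x"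
  using has_bochner_integral_integral_eq[OF
      has_bochner_integral_scaleR_left[OF rl_kernel_convolution[OF assms, of 1 t 0], of x]]
  by (simp add: rl_integral_def)

lemma rl_integral_add:
  "0 < c \<Longrightarrow> causal_bounded M t f \<Longrightarrow> causal_bounded M' t g \<Longrightarrow>
    rl_integral c (\<lambda>s. f s + g s) t = rl_integral c f t + rl_integral c g t"
  by (simp add: rl_integral_def scaleR_add_right rl_integral_bound(1))

lemma rl_integral_diff:
  "0 < c \<Longrightarrow> causal_bounded M t f \<Longrightarrow> causal_bounded M' t g \<Longrightarrow>
    rl_integral c (\<lambda>s. f s - g s) t = rl_integral c f t - rl_integral c g t"
  by (simp add: rl_integral_def scaleR_diff_right rl_integral_bound(1))

lemma rl_integral_bounded_linear:
  assumes "0 < c" "causal_bounded M t f" "bounded_linear L"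
  shows "rl_integral c (\<lambda>s. L (f s)) t = L (rl_integral c f t)"
  using integral_bounded_linear[OF assms(3) rl_integral_bound(1)[OF assms(2,1)]]
  by (simp add: rl_integral_def linear_simps[OF assms(3)])

text \<open>
  Here \<open>w\<close> plays the part of \<open>z'\<close>: writing \<open>z\<close> as the integral of \<open>w\<close>, instead of \<open>w\<close> as the derivative
  of \<open>z\<close>, replaces integration by parts against a singular kernel by the semigroup law. The
  function \<open>g\<close> is the inhomogeneity that the equation forces, so what is shown is that
  convolution with the resolvent kernel recovers \<open>z\<close> from \<open>g\<close> and the initial value.
\<close>

lemma variation_of_constants_riemann_liouville:
  fixes A :: "real^'n^'n" and w :: "real \<Rightarrow> real^'n" and z0 :: "real^'n"
  assumes \<alpha>: "0 < \<alpha>" "\<alpha> < 1" and w: "causal_bounded M t w" and t: "0 < t"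
  defines "z \<equiv> \<lambda>s. rl_kernel 1 s *\<^sub>R z0 + rl_integral 1 w s"
  defines "g \<equiv> \<lambda>s. rl_integral (1 - \<alpha>) w s - A *v z s"
  shows "has_bochner_integral lborel
      (\<lambda>\<tau>. \<Sum>l. rl_kernel (\<alpha> * real l + \<alpha>) (t - \<tau>) *\<^sub>R (matrix_pow A l *v g \<tau>))
      (z t - (\<Sum>l. rl_kernel (\<alpha> * real l + 1) t *\<^sub>R (matrix_pow A l *v z0)))"
proof -
  obtain C D where CD: "0 \<le> C" "0 \<le> D" "\<And>l x. norm (matrix_pow A l *v x) \<le> D * C ^ l * norm x"
    using matrix_pow_vector_bound by blast
  have bl: "bounded_linear ((*v) M)" for M :: "real^'n^'n" by simp
  obtain Mz where z: "causal_bounded Mz t z"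
    unfolding z_def using causal_bounded_add[OF causal_bounded_heaviside causal_bounded_rl_integral[OF w]] 
    by (meson zero_less_one)
  have h: "causal_bounded (M * rl_kernel (1 - \<alpha> + 1) t) t (rl_integral (1 - \<alpha>) w)"
    using \<alpha> by (intro causal_bounded_rl_integral[OF w]) auto
  have Az: "causal_bounded (onorm ((*v) A) * Mz) t (\<lambda>s. A *v z s)"
    by (intro causal_bounded_bounded_linear[OF z bl] onorm[OF bl] onorm_pos_le[OF bl])
  obtain Mg where g: "causal_bounded Mg t g"
    unfolding g_def using causal_bounded_diff[OF h Az] by blast
  have Mnn: "0 \<le> Mz" "0 \<le> Mg" using z g by (auto simp: causal_bounded_def)
  \<comment> \<open>The remainder after \<open>l\<close> Neumann iterations; the case \<open>l = 0\<close> is separate since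
    the kernel of order \<open>0\<close> would be a Dirac mass.\<close>
  define Z where "Z l = matrix_pow A l *v (if l = 0 then z t else rl_integral (\<alpha> * real l) z t)" for l
  have RL_z: "rl_integral c z t = rl_kernel (c + 1) t *\<^sub>R z0 + rl_integral (c + 1) w t" if "0 < c" for c
    using that unfolding z_def
    by (subst rl_integral_add[OF _ causal_bounded_heaviside causal_bounded_rl_integral[OF w]])
      (auto simp: rl_integral_heaviside rl_integral_semigroup[OF w])
  have T: "matrix_pow A l *v rl_integral (\<alpha> * real l + \<alpha>) g t =
      (Z l - Z (Suc l)) - rl_kernel (\<alpha> * real l + 1) t *\<^sub>R (matrix_pow A l *v z0)" for l
  proof -
    have c: "0 < \<alpha> * real l + \<alpha>" using \<alpha> by (intro add_nonneg_pos) auto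
    have "rl_integral (\<alpha> * real l + \<alpha>) g t =
        rl_integral (\<alpha> * real l + \<alpha>) (rl_integral (1 - \<alpha>) w) t - A *v rl_integral (\<alpha> * real l + \<alpha>) z t"
      unfolding g_def
      by (simp only: rl_integral_diff[OF c h Az] rl_integral_bounded_linear[OF c z bl])
    also have "rl_integral (\<alpha> * real l + \<alpha>) (rl_integral (1 - \<alpha>) w) t = rl_integral (\<alpha> * real l + 1) w t"
      using \<alpha> c by (subst rl_integral_semigroup[OF w]) auto
    also have "\<dots> = (if l = 0 then z t else rl_integral (\<alpha> * real l) z t) - rl_kernel (\<alpha> * real l + 1) t *\<^sub>R z0"
      using \<alpha> t by (auto simp: RL_z) (simp add: z_def rl_kernel_one)
    finally have "rl_integral (\<alpha> * real l + \<alpha>) g t =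
        (if l = 0 then z t else rl_integral (\<alpha> * real l) z t) - rl_kernel (\<alpha> * real l + 1) t *\<^sub>R z0
          - A *v rl_integral (\<alpha> * real l + \<alpha>) z t" .
    moreover have "Z (Suc l) = matrix_pow A (Suc l) *v rl_integral (\<alpha> * real l + \<alpha>) z t"
      by (simp add: Z_def distrib_left add.commute del: matrix_pow.simps)
    ultimately show ?thesis
      by (simp add: Z_def matrix_vector_mult_diff_distrib matrix_vector_mult_scaleR matrix_pow_Suc_right
          del: matrix_pow.simps)
  qed
  have "(\<lambda>l. Z (Suc l)) \<longlonglongrightarrow> 0"
  proof (rule Lim_null_comparison)
    show "eventually (\<lambda>l. norm (Z (Suc l)) \<le> D * C * Mz * (C ^ l * rl_kernel (\<alpha> * real l + (\<alpha> + 1)) t)) sequentially"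
    proof (intro always_eventually allI)
      fix l
      have c: "0 < \<alpha> * real (Suc l)" using \<alpha> by auto
      have "norm (Z (Suc l)) \<le> D * C ^ Suc l * norm (rl_integral (\<alpha> * real (Suc l)) z t)"
        unfolding Z_def using CD(3)[of "Suc l"] by simp
      also have "\<dots> \<le> D * C ^ Suc l * (Mz * rl_kernel (\<alpha> * real (Suc l) + 1) t)"
        using CD c by (intro mult_left_mono rl_integral_bound(3)[OF z]) auto
      finally show "norm (Z (Suc l)) \<le> D * C * Mz * (C ^ l * rl_kernel (\<alpha> * real l + (\<alpha> + 1)) t)"
        by (simp add: algebra_simps)
    qed
    show "(\<lambda>l. D * C * Mz * (C ^ l * rl_kernel (\<alpha> * real l + (\<alpha> + 1)) t)) \<longlonglongrightarrow> 0"
      using tendsto_mult_left[OF summable_LIMSEQ_zero[OF summable_rl_kernel[of \<alpha> "\<alpha> + 1" C t]], of "D * C * Mz"]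
        \<alpha> CD by simp
  qed
  then have Z0: "Z \<longlonglongrightarrow> 0" by (simp add: filterlim_sequentially_Suc)
  have sumP: "summable (\<lambda>l. rl_kernel (\<alpha> * real l + 1) t *\<^sub>R (matrix_pow A l *v z0))"
  proof (rule summable_comparison_test[OF _ summable_mult])
    show "summable (\<lambda>l. C ^ l * rl_kernel (\<alpha> * real l + 1) t)"
      using \<alpha> CD by (intro summable_rl_kernel) auto
    show "\<exists>N. \<forall>l\<ge>N. norm (rl_kernel (\<alpha> * real l + 1) t *\<^sub>R (matrix_pow A l *v z0))
        \<le> (D * norm z0) * (C ^ l * rl_kernel (\<alpha> * real l + 1) t)"
    proof (intro exI[of _ 0] allI impI)
      fix l :: nat
      have "0 \<le> rl_kernel (\<alpha> * real l + 1) t" using \<alpha> by (intro rl_kernel_nonneg add_nonneg_pos) auto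
      then show "norm (rl_kernel (\<alpha> * real l + 1) t *\<^sub>R (matrix_pow A l *v z0))
        \<le> (D * norm z0) * (C ^ l * rl_kernel (\<alpha> * real l + 1) t)"
        using mult_left_mono[OF CD(3)[of l z0], of "rl_kernel (\<alpha> * real l + 1) t"] by (simp add: mult_ac)
    qed
  qed
  have "Z 0 = z t" by (simp add: Z_def)
  then have series: "(\<lambda>l. matrix_pow A l *v rl_integral (\<alpha> * real l + \<alpha>) g t) sums
      (z t - (\<Sum>l. rl_kernel (\<alpha> * real l + 1) t *\<^sub>R (matrix_pow A l *v z0)))"
    unfolding T using sums_diff[OF telescope_sums'[OF Z0] summable_sums[OF sumP]] by simp
  have pos: "0 < \<alpha> * real l + \<alpha>" for l using \<alpha> by (intro add_nonneg_pos) auto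
  \<comment> \<open>Interchange of sum and integral: since \<open>g\<close> is bounded, the \<open>L^1\<close> norms of the terms are
    dominated by a scalar Mittag-Leffler series.\<close>
  have gl: "causal_bounded (D * C ^ l * Mg) t (\<lambda>\<tau>. matrix_pow A l *v g \<tau>)" for l
    using CD by (intro causal_bounded_bounded_linear[OF g bl]) auto
  let ?f = "\<lambda>l \<tau>. rl_kernel (\<alpha> * real l + \<alpha>) (t - \<tau>) *\<^sub>R (matrix_pow A l *v g \<tau>)"
  have 1: "integrable lborel (?f l)" for l
    by (rule rl_integral_bound(1)[OF gl pos])
  have 2: "summable (\<lambda>l. norm (?f l \<tau>))" for \<tau>
  proof (rule summable_comparison_test[OF _ summable_mult])
    show "summable (\<lambda>l. C ^ l * rl_kernel (\<alpha> * real l + \<alpha>) (t - \<tau>))"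
      using \<alpha> CD by (intro summable_rl_kernel) auto
    show "\<exists>N. \<forall>l\<ge>N. norm (norm (?f l \<tau>)) \<le> (D * norm (g \<tau>)) * (C ^ l * rl_kernel (\<alpha> * real l + \<alpha>) (t - \<tau>))"
    proof (intro exI[of _ 0] allI impI)
      fix l :: nat
      show "norm (norm (?f l \<tau>)) \<le> (D * norm (g \<tau>)) * (C ^ l * rl_kernel (\<alpha> * real l + \<alpha>) (t - \<tau>))"
        using mult_left_mono[OF CD(3)[of l "g \<tau>"] rl_kernel_nonneg[OF pos]] rl_kernel_nonneg[OF pos, of l "t - \<tau>"]
        by (simp add: mult_ac)
    qed
  qed
  have 3: "summable (\<lambda>l. \<integral>\<tau>. norm (?f l \<tau>) \<partial>lborel)"
  proof (rule summable_comparison_test[OF _ summable_mult])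
    show "summable (\<lambda>l. C ^ l * rl_kernel (\<alpha> * real l + (\<alpha> + 1)) t)"
      using \<alpha> CD by (intro summable_rl_kernel) auto
    show "\<exists>N. \<forall>l\<ge>N. norm (\<integral>\<tau>. norm (?f l \<tau>) \<partial>lborel) \<le> (D * Mg) * (C ^ l * rl_kernel (\<alpha> * real l + (\<alpha> + 1)) t)"
    proof (intro exI[of _ 0] allI impI)
      fix l :: nat
      have "norm (\<integral>\<tau>. norm (?f l \<tau>) \<partial>lborel) = (\<integral>\<tau>. norm (?f l \<tau>) \<partial>lborel)"
        by (simp add: integral_nonneg_AE)
      then show "norm (\<integral>\<tau>. norm (?f l \<tau>) \<partial>lborel) \<le> (D * Mg) * (C ^ l * rl_kernel (\<alpha> * real l + (\<alpha> + 1)) t)"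
        using rl_integral_bound(2)[OF gl[of l] pos[of l]] by (simp add: mult_ac add.assoc)
    qed
  qed
  have "(\<lambda>l. integral\<^sup>L lborel (?f l)) sums (\<integral>\<tau>. (\<Sum>l. ?f l \<tau>) \<partial>lborel)"
    by (rule sums_integral[OF 1 AE_I2[OF 2] 3])
  moreover have "integral\<^sup>L lborel (?f l) = matrix_pow A l *v rl_integral (\<alpha> * real l + \<alpha>) g t" for l
    using rl_integral_bounded_linear[OF pos g bl] by (simp add: rl_integral_def)
  ultimately have "(\<integral>\<tau>. (\<Sum>l. ?f l \<tau>) \<partial>lborel) = z t - (\<Sum>l. rl_kernel (\<alpha> * real l + 1) t *\<^sub>R (matrix_pow A l *v z0))"
    using series sums_unique2 by auto
  moreover have "integrable lborel (\<lambda>\<tau>. \<Sum>l. ?f l \<tau>)"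
    by (rule integrable_suminf[OF 1 AE_I2[OF 2] 3])
  ultimately show ?thesis by (simp add: has_bochner_integral_iff)
qed

section \<open>Removing the tempering\<close>

text \<open>
  Passage from the Lebesgue integrals on the line used above to gauge integrals on an interval.
  Only the open interval matters, which disposes of the values of powers of \<open>0\<close> at the
  singular endpoint.
\<close>

lemma integral_Icc_from_lborel:
  fixes \<Phi> \<Psi> :: "real \<Rightarrow> 'a::euclidean_space"
  assumes \<Psi>: "has_bochner_integral lborel \<Psi> I"
    and out: "\<And>\<tau>. \<tau> \<notin> {a<..<b} \<Longrightarrow> \<Psi> \<tau> = 0"
    and eq: "\<And>\<tau>. \<tau> \<in> {a<..<b} \<Longrightarrow> \<Phi> \<tau> = \<Psi> \<tau>"
  shows "\<Phi> absolutely_integrable_on {a..b}" and "integral {a..b} \<Phi> = I"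
proof -
  have int: "integrable lborel \<Psi>" "integral\<^sup>L lborel \<Psi> = I"
    using \<Psi> by (auto simp: has_bochner_integral_iff)
  have neg: "negligible {a, b}" by simp
  have eq': "\<Phi> \<tau> = \<Psi> \<tau>" if "\<tau> \<in> {a..b} - {a, b}" for \<tau>
    using that by (intro eq) auto
  have "\<Psi> absolutely_integrable_on UNIV"
    using int(1) by (simp add: set_integrable_def integrable_completion)
  then have "\<Psi> absolutely_integrable_on {a..b}"
    by (rule set_integrable_subset) auto
  then show "\<Phi> absolutely_integrable_on {a..b}"
    by (rule absolutely_integrable_spike[OF _ neg eq'])
  have "(\<Psi> has_integral I) UNIV"
    using has_integral_integral_lborel[OF int(1)] int(2) by simp
  also have "\<Psi> = (\<lambda>\<tau>. if \<tau> \<in> {a..b} then \<Psi> \<tau> else 0)"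
    by (auto simp: fun_eq_iff intro!: out)
  finally have "(\<Psi> has_integral I) {a..b}"
    by (simp only: has_integral_restrict_UNIV)
  then show "integral {a..b} \<Phi> = I"
    by (intro integral_unique has_integral_spike[OF neg eq'])
qed

lemma rl_integral_eq_integral:
  assumes f: "causal_bounded M t f" and c: "0 < c"
    and eq: "\<And>s. 0 < s \<Longrightarrow> s < t \<Longrightarrow> \<phi> s = ((t - s) powr (c - 1) / Gamma c) *\<^sub>R f s"
  shows "integral {0..t} \<phi> = rl_integral c f t"
  unfolding rl_integral_def
proof (rule integral_Icc_from_lborel(2))
  show "has_bochner_integral lborel (\<lambda>s. rl_kernel c (t - s) *\<^sub>R f s) (\<integral>s. rl_kernel c (t - s) *\<^sub>R f s \<partial>lborel)"
    by (rule has_bochner_integral_integrable[OF rl_integral_bound(1)[OF f c]])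
qed (use f eq in \<open>auto simp: rl_kernel_def causal_bounded_def\<close>)

lemma vector_derivative_within_initial_interval:
  assumes "(v has_vector_derivative d) (at s within {0..T})" "0 < t" "t \<le> T" "s \<in> {0..t}"
  shows "vector_derivative v (at s within {0..t}) = d"
  using vector_derivative_within_cbox[of 0 t s v d]
    has_vector_derivative_within_subset[OF assms(1), of "{0..t}"] assms(2-4)
  by auto

lemma mittag_leffler_eq_mittag_leffler2: "mittag_leffler \<alpha> = mittag_leffler2 \<alpha> 1"
  by (simp add: fun_eq_iff mittag_leffler_def mittag_leffler2_def)

lemma mittag_leffler_zero: "mittag_leffler \<alpha> (0 :: real^'n^'n) = mat 1"
proof -
  have "matrix_pow (0 :: real^'n^'n) l = (if l = 0 then mat 1 else 0)" for l
    by (cases l) (auto simp: matrix_matrix_mult_def vec_eq_iff)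
  then have "mittag_leffler \<alpha> (0 :: real^'n^'n) = (\<Sum>l. if l = 0 then mat 1 else 0)"
    unfolding mittag_leffler_def by (intro suminf_cong) auto
  also have "\<dots> = mat 1"
    using suminf_finite[of "{0}" "\<lambda>l::nat. if l = 0 then (mat 1 :: real^'n^'n) else 0"] by simp
  finally show ?thesis .
qed

theorem theorem3p1:
  fixes \<rho> \<alpha> T :: real
    and u :: "real \<Rightarrow> real^'m"
    and A :: "real^'n^'n"
    and B :: "real^'m^'n"
    and y0 :: "real^'n"
    and y :: "real \<Rightarrow> real^'n"
    and N :: "real^'n^'n \<Rightarrow> real"
  assumes "\<rho> > 0" and "0 < \<alpha>" and "\<alpha> < 1" and "T > 0"
    and "matrix_norm N"
    and "\<And>s::real. s \<ge> N A powr (1 / \<alpha>) \<Longrightarrow> det (((s + \<rho>) powr \<alpha>) *\<^sub>R mat 1 - A) \<noteq> 0"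
    and "tempered_solution \<alpha> \<rho> T A B u y0 y"
  shows "\<forall>t\<in>{0..T}.
    (\<lambda>\<tau>. (exp (- \<rho> * (t - \<tau>)) * (t - \<tau>) powr (\<alpha> - 1)) *\<^sub>R
          (mittag_leffler2 \<alpha> \<alpha> (((t - \<tau>) powr \<alpha>) *\<^sub>R A) *v (B *v u \<tau>)))
      absolutely_integrable_on {0..t} \<and>
    y t = exp (- \<rho> * t) *\<^sub>R (mittag_leffler \<alpha> ((t powr \<alpha>) *\<^sub>R A) *v y0) +
      integral {0..t} (\<lambda>\<tau>. (exp (- \<rho> * (t - \<tau>)) * (t - \<tau>) powr (\<alpha> - 1)) *\<^sub>R
          (mittag_leffler2 \<alpha> \<alpha> (((t - \<tau>) powr \<alpha>) *\<^sub>R A) *v (B *v u \<tau>)))"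
proof
  note \<alpha> = assms(2,3) and sol = assms(7)
  fix t assume t_mem: "t \<in> {0..T}"
  let ?S = "\<lambda>\<tau>. (exp (- \<rho> * (t - \<tau>)) * (t - \<tau>) powr (\<alpha> - 1)) *\<^sub>R
          (mittag_leffler2 \<alpha> \<alpha> (((t - \<tau>) powr \<alpha>) *\<^sub>R A) *v (B *v u \<tau>))"
  have y_eq: "caputo_tempered \<alpha> \<rho> y t = A *v y t + B *v u t" if "t \<in> {0..T}" for t
    using sol that by (auto simp: tempered_solution_def)
  have y0: "y 0 = y0" using sol by (simp add: tempered_solution_def)
  obtain y' where y': "\<And>t. t \<in> {0..T} \<Longrightarrow> (y has_vector_derivative y' t) (at t within {0..T})"
    and cont_y': "continuous_on {0..T} y'"
    using sol unfolding tempered_solution_def C1_on_Icc_def by blast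
  have cont_y: "continuous_on {0..T} y"
    unfolding continuous_on_eq_continuous_within
    using y' has_vector_derivative_continuous by blast
  \<comment> \<open>The derivative of \<open>exp (\<rho> s) y(s)\<close>, and its causal truncation \<open>w\<close>.\<close>
  define z' where "z' s = exp (\<rho> * s) *\<^sub>R (\<rho> *\<^sub>R y s + y' s)" for s
  have cont_z': "continuous_on {0..T} z'"
    unfolding z'_def by (intro continuous_intros cont_y cont_y')
  define w where "w s = indicator {0<..T} s *\<^sub>R z' s" for s
  obtain M where M: "causal_bounded M t w"
  proof -
    have "bounded (z' ` {0..T})"
      by (intro compact_imp_bounded compact_continuous_image cont_z') auto
    then obtain M where M: "0 < M" "\<And>s. s \<in> {0..T} \<Longrightarrow> norm (z' s) \<le> M"
      by (auto simp: bounded_pos)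
    have "w = (\<lambda>s. indicator {0<..T} s *\<^sub>R (indicator {0..T} s *\<^sub>R z' s))"
      by (auto simp: w_def indicator_def fun_eq_iff)
    also have "\<dots> \<in> borel_measurable borel"
      by (intro borel_measurable_scaleR borel_measurable_continuous_on_indicator cont_z') auto
    finally have "causal_bounded M t w"
      using M by (auto simp: causal_bounded_def w_def indicator_def)
    then show thesis by (rule that)
  qed
  have M': "causal_bounded M s w" if "s \<le> t" for s
    by (rule causal_bounded_mono[OF M that])
  show "?S absolutely_integrable_on {0..t} \<and>
    y t = exp (- \<rho> * t) *\<^sub>R (mittag_leffler \<alpha> ((t powr \<alpha>) *\<^sub>R A) *v y0) + integral {0..t} ?S"
  proof (cases "t = 0")
    \<comment> \<open>Separate because \<open>rl_kernel 1\<close> vanishes at \<open>0\<close>, whereas \<open>E_\<alpha>(0)\<close> is the identity.\<close>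
    case True
    have "?S absolutely_integrable_on {t..t}"
      by (rule integral_Icc_from_lborel(1)[OF has_bochner_integral_zero]) auto
    with True show ?thesis
      by (simp add: mittag_leffler_zero y0)
  next
    case False
    with t_mem have t: "0 < t" "t \<le> T" by auto
    define z where "z s = rl_kernel 1 s *\<^sub>R y0 + rl_integral 1 w s" for s
    define g where "g s = rl_integral (1 - \<alpha>) w s - A *v z s" for s
    have z_eq: "z s = exp (\<rho> * s) *\<^sub>R y s" if s: "0 < s" "s \<le> t" for s
    proof -
      have "((\<lambda>r. exp (\<rho> * r) *\<^sub>R y r) has_vector_derivative z' r) (at r within {0..s})"
        if "r \<in> {0..s}" for r
        unfolding z'_def using that s t
        by (auto intro!: derivative_eq_intros has_vector_derivative_within_subset[OF y', of r]
            simp: algebra_simps)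
      then have "(z' has_integral exp (\<rho> * s) *\<^sub>R y s - exp (\<rho> * 0) *\<^sub>R y 0) {0..s}"
        using s by (intro fundamental_theorem_of_calculus) auto
      then have "integral {0..s} z' = exp (\<rho> * s) *\<^sub>R y s - y0"
        by (simp add: integral_unique y0)
      moreover have "integral {0..s} z' = rl_integral 1 w s"
        using s t by (intro rl_integral_eq_integral[OF M'[OF s(2)]]) (auto simp: w_def)
      ultimately show ?thesis
        using s by (simp add: z_def rl_kernel_one)
    qed
    \<comment> \<open>This is where the differential equation enters: the tempered derivative of \<open>y\<close> is
      \<open>exp (- \<rho> s)\<close> times the integral of order \<open>1 - \<alpha>\<close> of \<open>w\<close>. Through it \<open>B u\<close> inherits
      measurability and boundedness on the open interval.\<close>
    have g_eq: "g s = exp (\<rho> * s) *\<^sub>R (B *v u s)" if s: "0 < s" "s < t" for s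
    proof -
      have "rl_integral (1 - \<alpha>) w s = integral {0..s} (\<lambda>r. exp (\<rho> * s) *\<^sub>R (1 / Gamma (1 - \<alpha>)) *\<^sub>R
          ((exp (- \<rho> * (s - r)) * (s - r) powr (- \<alpha>)) *\<^sub>R
            (\<rho> *\<^sub>R y r + vector_derivative y (at r within {0..s}))))"
      proof (rule rl_integral_eq_integral[symmetric])
        show "causal_bounded M s w" using s by (intro M') auto
        fix r assume r: "0 < r" "r < s"
        have "vector_derivative y (at r within {0..s}) = y' r"
          using r s t by (intro vector_derivative_within_initial_interval[OF y']) auto
        moreover have "exp (\<rho> * r) = exp (\<rho> * s) * exp (- \<rho> * (s - r))"
          by (simp add: exp_add[symmetric] algebra_simps)
        ultimately show "exp (\<rho> * s) *\<^sub>R (1 / Gamma (1 - \<alpha>)) *\<^sub>R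
          ((exp (- \<rho> * (s - r)) * (s - r) powr (- \<alpha>)) *\<^sub>R
            (\<rho> *\<^sub>R y r + vector_derivative y (at r within {0..s}))) =
          ((s - r) powr (1 - \<alpha> - 1) / Gamma (1 - \<alpha>)) *\<^sub>R w r"
          using r s t by (simp add: w_def z'_def mult_ac)
      qed (use \<alpha> in auto)
      then have "rl_integral (1 - \<alpha>) w s = exp (\<rho> * s) *\<^sub>R caputo_tempered \<alpha> \<rho> y s"
        by (simp only: caputo_tempered_def integral_cmul)
      also have "\<dots> = A *v z s + exp (\<rho> * s) *\<^sub>R (B *v u s)"
        using y_eq[of s] z_eq[of s] s t by (simp add: scaleR_add_right matrix_vector_mult_scaleR)
      finally show ?thesis by (simp add: g_def)
    qed
    let ?K = "\<lambda>\<tau>. \<Sum>l. rl_kernel (\<alpha> * real l + \<alpha>) (t - \<tau>) *\<^sub>R (matrix_pow A l *v g \<tau>)"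
    let ?P = "\<Sum>l. rl_kernel (\<alpha> * real l + 1) t *\<^sub>R (matrix_pow A l *v y0)"
    have "has_bochner_integral lborel ?K (z t - ?P)"
      unfolding g_def z_def
      by (rule variation_of_constants_riemann_liouville[OF \<alpha> M t(1)])
    then have K: "has_bochner_integral lborel (\<lambda>\<tau>. exp (- \<rho> * t) *\<^sub>R ?K \<tau>) (exp (- \<rho> * t) *\<^sub>R (z t - ?P))"
      by (intro has_bochner_integral_scaleR_right)
    have g0: "g \<tau> = 0" if "\<tau> \<le> 0" for \<tau>
      using that causal_bounded_rl_integral[OF M, of 1] causal_bounded_rl_integral[OF M, of "1 - \<alpha>"] \<alpha>
      by (auto simp: g_def z_def causal_bounded_def rl_kernel_def)
    have out: "exp (- \<rho> * t) *\<^sub>R ?K \<tau> = 0" if "\<tau> \<notin> {0<..<t}" for \<tau>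
    proof (cases "\<tau> \<le> 0")
      case False
      with that have "rl_kernel c (t - \<tau>) = 0" for c by (simp add: rl_kernel_def)
      then show ?thesis by simp
    qed (simp add: g0)
    have inside: "?S \<tau> = exp (- \<rho> * t) *\<^sub>R ?K \<tau>" if "\<tau> \<in> {0<..<t}" for \<tau>
    proof -
      have "?K \<tau> = (t - \<tau>) powr (\<alpha> - 1) *\<^sub>R (mittag_leffler2 \<alpha> \<alpha> (((t - \<tau>) powr \<alpha>) *\<^sub>R A) *v g \<tau>)"
        using that \<alpha> by (intro mittag_leffler2_eq_rl_kernel_series[symmetric]) auto
      moreover have "exp (- \<rho> * (t - \<tau>)) = exp (- \<rho> * t) * exp (\<rho> * \<tau>)"
        by (simp add: exp_add[symmetric] algebra_simps)
      ultimately show ?thesis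
        using that by (simp add: g_eq matrix_vector_mult_scaleR mult_ac)
    qed
    have "?P = mittag_leffler \<alpha> ((t powr \<alpha>) *\<^sub>R A) *v y0"
      using mittag_leffler2_eq_rl_kernel_series[of \<alpha> 1 t A y0] \<alpha> t
      by (simp add: mittag_leffler_eq_mittag_leffler2)
    moreover have "exp (- \<rho> * t) *\<^sub>R z t = y t"
      using z_eq[of t] t by (simp add: exp_minus)
    ultimately show ?thesis
      using integral_Icc_from_lborel[OF K out inside] by (simp add: scaleR_diff_right)
  qed
qed

end
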